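(* Let $J=(q_i)_{i\ge1}$ be a sequence of pairwise relatively prime non-negative integers, and let $I=(a_j)_{j\ge1}$ be a sequence with every $a_j\in J$ and each $q_i$ appearing infinitely many times in $I$. Let $\mathfrak{n}=\prod_{k\ge1}q_k^{\infty}$. Then for every infinite generalized integer $\mathfrak{m}$ coprime with $\mathfrak{n}$ there exists a simple Riesz group of rank one $G(\mathfrak{m})$ such that: (i) for every $q_i$ there is a countably generated interval $D_i\subseteq G(\mathfrak{m})^+$ with $tD_i\neq G(\mathfrak{m})^+$ for every positive integer $t\le q_i-1$ and $q_iD_i=G(\mathfrak{m})^+$; (ii) $G(\mathfrak{m})$ is isomorphic, as an abelian group, to $\mathbb{Z}_{\mathfrak{n}\cdot\mathfrak{m}}$.
   Context: Partially ordered abelian group $(G,G^+)$; simple: $G\neq0$ and every nonzero $u\in G^+$ is an order-unit. Riesz group: $x\le y_1+y_2$ in $G^+$ implies $x=x_1+x_2$ with $x_j\in G^+$, $x_j\le y_j$. Rank one: isomorphic to a nonzero subgroup of $\mathbb{Q}$. A generalized integer is a map $\mathfrak{n}$ from the primes to $\{0,1,\dots,\infty\}$, written $\prod_p p^{\mathfrak{n}(p)}$; $\prod_k q_k^\infty$ is the one taking value $\infty$ at each prime dividing some $q_k$ and $0$ elsewhere. It is finite if it never takes $\infty$ and is nonzero at finitely many primes, infinite otherwise; products add exponents; $\mathfrak{n},\mathfrak{m}$ coprime means for each prime one of the exponents is $0$. $\mathbb{Z}_{\mathfrak{n}}=\{a/b\in\mathbb{Q}: a\in\mathbb{Z},\ b\mid\mathfrak{n}\}$.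 An interval in $G^+$ is a nonempty, upward directed, order-hereditary subset of $G^+$; it is countably generated if it has a countable cofinal subset. $X+Y=\{z\in G^+: z\le x+y,\ x\in X,\ y\in Y\}$, $tX$ the $t$-fold sum. *)

theory Defs
  imports "HOL-Computational_Algebra.Primes" "HOL-Library.Extended_Nat" "HOL-Library.Countable_Set"
begin

text \<open>A group of rank one is (up to isomorphism) a nonzero subgroup of the rationals, so we
realise the group as a set G of rationals with its own positive cone P (the order need not be
the one induced from the rationals). The order is: x below y iff y - x lies in P.\<close>

definition subgroup_rat :: "rat set \<Rightarrow> bool" where
  "subgroup_rat G \<longleftrightarrow> 0 \<in> G \<and> (\<forall>x\<in>G. \<forall>y\<in>G. x + y \<in> G) \<and> (\<forall>x\<in>G. - x \<in> G)"

definition pleq :: "rat set \<Rightarrow> rat \<Rightarrow> rat \<Rightarrow> bool" where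
  "pleq P x y \<longleftrightarrow> y - x \<in> P"

definition po_group :: "rat set \<Rightarrow> rat set \<Rightarrow> bool" where
  "po_group G P \<longleftrightarrow> subgroup_rat G \<and> P \<subseteq> G \<and> 0 \<in> P \<and>
     (\<forall>x\<in>P. \<forall>y\<in>P. x + y \<in> P) \<and> (\<forall>x\<in>P. - x \<in> P \<longrightarrow> x = 0)"

definition order_unit :: "rat set \<Rightarrow> rat set \<Rightarrow> rat \<Rightarrow> bool" where
  "order_unit G P u \<longleftrightarrow> u \<in> P \<and> (\<forall>x\<in>G. \<exists>n::nat. pleq P x (of_nat n * u))"

definition simple_group :: "rat set \<Rightarrow> rat set \<Rightarrow> bool" where
  "simple_group G P \<longleftrightarrow> G \<noteq> {0} \<and> (\<forall>u\<in>P. u \<noteq> 0 \<longrightarrow> order_unit G P u)"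

definition riesz_group :: "rat set \<Rightarrow> rat set \<Rightarrow> bool" where
  "riesz_group G P \<longleftrightarrow> (\<forall>x\<in>P. \<forall>y1\<in>P. \<forall>y2\<in>P. pleq P x (y1 + y2) \<longrightarrow>
      (\<exists>x1\<in>P. \<exists>x2\<in>P. x = x1 + x2 \<and> pleq P x1 y1 \<and> pleq P x2 y2))"

definition rank_one :: "rat set \<Rightarrow> bool" where
  "rank_one G \<longleftrightarrow> subgroup_rat G \<and> G \<noteq> {0}"

definition interval :: "rat set \<Rightarrow> rat set \<Rightarrow> bool" where
  "interval P X \<longleftrightarrow> X \<noteq> {} \<and> X \<subseteq> P \<and>
     (\<forall>x\<in>X. \<forall>y\<in>X. \<exists>z\<in>X. pleq P x z \<and> pleq P y z) \<and>
     (\<forall>x\<in>X. \<forall>y\<in>P. pleq P y x \<longrightarrow> y \<in> X)"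

definition countably_generated :: "rat set \<Rightarrow> rat set \<Rightarrow> bool" where
  "countably_generated P X \<longleftrightarrow> (\<exists>C. countable C \<and> C \<subseteq> X \<and> (\<forall>x\<in>X. \<exists>c\<in>C. pleq P x c))"

definition isum :: "rat set \<Rightarrow> rat set \<Rightarrow> rat set \<Rightarrow> rat set" where
  "isum P X Y = {z\<in>P. \<exists>x\<in>X. \<exists>y\<in>Y. pleq P z (x + y)}"

text \<open>t-fold sum tX; only used for t \<ge> 1 (and then 1X = X for an interval X).\<close>
fun imult :: "rat set \<Rightarrow> nat \<Rightarrow> rat set \<Rightarrow> rat set" where
  "imult P 0 X = {0}"
| "imult P (Suc 0) X = X"
| "imult P (Suc (Suc n)) X = isum P (imult P (Suc n) X) X"

type_synonym gen_int = "nat \<Rightarrow> enat"  \<comment> \<open>only values at primes are relevant\<close>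

definition gi_finite :: "gen_int \<Rightarrow> bool" where
  "gi_finite n \<longleftrightarrow> (\<forall>p. prime p \<longrightarrow> n p \<noteq> \<infinity>) \<and> finite {p. prime p \<and> n p \<noteq> 0}"

definition gi_infinite :: "gen_int \<Rightarrow> bool" where
  "gi_infinite n \<longleftrightarrow> \<not> gi_finite n"

definition gi_mult :: "gen_int \<Rightarrow> gen_int \<Rightarrow> gen_int" where
  "gi_mult n m = (\<lambda>p. n p + m p)"

definition gi_coprime :: "gen_int \<Rightarrow> gen_int \<Rightarrow> bool" where
  "gi_coprime n m \<longleftrightarrow> (\<forall>p. prime p \<longrightarrow> n p = 0 \<or> m p = 0)"

definition gi_inf_prod :: "(nat \<Rightarrow> nat) \<Rightarrow> gen_int" where
  "gi_inf_prod q = (\<lambda>p. if prime p \<and> (\<exists>k\<ge>1. p dvd q k) then \<infinity> else 0)"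

definition gi_dvd :: "nat \<Rightarrow> gen_int \<Rightarrow> bool" where
  "gi_dvd b n \<longleftrightarrow> b > 0 \<and> (\<forall>p. prime p \<longrightarrow> enat (multiplicity p b) \<le> n p)"

definition Z_gi :: "gen_int \<Rightarrow> rat set" where
  "Z_gi n = {of_int a / of_nat b | a b. gi_dvd b n}"

definition group_iso_rat :: "rat set \<Rightarrow> rat set \<Rightarrow> bool" where
  "group_iso_rat G H \<longleftrightarrow> (\<exists>f. bij_betw f G H \<and> (\<forall>x\<in>G. \<forall>y\<in>G. f (x + y) = f x + f y))"

end

theory Submission
  imports Defs
begin

text \<open>The cone is the union of an increasing chain of submonoids of the nonnegative rationals in
the group, each contained in the multiples of a single element. Refining a relation x1 + x2 = y1 + y2 means adjoining t, x1 - t, y1 - t and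
x2 - y1 + t for a suitable t. A combination of these four elements in which t cancels already lies
in the old monoid, while one involving t equals a prescribed element for only finitely many t; since
the group is dense, t can be chosen without putting any of finitely many forbidden elements into
the monoid. Order-units come for free, by adjoining n * v - x for n large. The interval for q is
generated by an increasing sequence d(k) such that t * d(k) - u is forbidden for t < q, where u is a
fixed positive element; the next term is a large element of order at least q modulo the current
monoid, which makes it possible to adjoin q * d(k) - x while keeping these elements out.\<close>

lemma subgroup_rat_mult_nat:
  assumes "subgroup_rat G" "x \<in> G"
  shows "of_nat n * x \<in> G"
  using assms by (induction n) (auto simp: subgroup_rat_def distrib_right)

lemma subgroup_rat_diff:
  assumes "subgroup_rat G" "x \<in> G" "y \<in> G"
  shows "x - y \<in> G"
  using assms unfolding subgroup_rat_def by (metis diff_conv_add_uminus)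

lemma subgroup_rat_mult_int:
  assumes "subgroup_rat G" "x \<in> G"
  shows "of_int k * x \<in> G"
proof (cases "k \<ge> 0")
  case True
  then show ?thesis
    using subgroup_rat_mult_nat[OF assms, of "nat k"] by simp
next
  case False
  then have "of_int k * x = - (of_nat (nat (- k)) * x)" by simp
  then show ?thesis
    using subgroup_rat_mult_nat[OF assms, of "nat (- k)"] assms(1)
    by (simp add: subgroup_rat_def)
qed

lemma subgroup_rat_common_generator:
  assumes G: "subgroup_rat G" and g: "g \<in> G" "g > 0" and h: "h \<in> G" "h \<ge> 0"
  obtains e i j where "e \<in> G" "e > 0" "g = of_nat i * e" "h = of_nat j * e"
proof -
  obtain a b where ab: "g = of_int a / of_int b" "b > 0"
    by (metis Fract_of_int_quotient Rat_cases)
  obtain c d where cd: "h = of_int c / of_int d" "d > 0"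
    by (metis Fract_of_int_quotient Rat_cases)
  have a: "a > 0" using ab g by (simp add: zero_less_divide_iff)
  have c: "c \<ge> 0" using cd h by (simp add: zero_le_divide_iff)
  define k where "k = gcd (a * d) (c * b)"
  define e :: rat where "e = of_int k / of_int (b * d)"
  have kpos: "k > 0" using a cd by (auto simp: k_def)
  obtain r s where rs: "r * (a * d) + s * (c * b) = k"
    using bezout_int[of "a * d" "c * b"] unfolding k_def by blast
  have "of_int k = (of_int r * (of_int a * of_int d) + of_int s * (of_int c * of_int b) :: rat)"
    using rs by (metis of_int_add of_int_mult)
  then have "e = of_int r * g + of_int s * h"
    using ab(2) cd(2) unfolding e_def ab(1) cd(1) by (simp add: add_divide_distrib)
  then have "e \<in> G"
    using G g h subgroup_rat_mult_int by (simp add: subgroup_rat_def)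
  moreover have "e > 0" using kpos ab cd by (simp add: e_def)
  moreover have "\<exists>i. g = of_nat i * e"
  proof -
    obtain i where i: "a * d = k * i" unfolding k_def by (meson dvdE gcd_dvd1)
    have "k * i > 0" using a cd(2) by (simp flip: i)
    then have "i > 0" using kpos by (rule zero_less_mult_pos)
    have "g = of_int (a * d) / of_int (b * d)" using ab(2) cd(2) unfolding ab(1) by simp
    then have "g = of_int i * e" unfolding i e_def by simp
    also have "\<dots> = of_nat (nat i) * e" using \<open>i > 0\<close> by simp
    finally show ?thesis by blast
  qed
  moreover have "\<exists>j. h = of_nat j * e"
  proof -
    obtain i where i: "c * b = k * i" unfolding k_def by (meson dvdE gcd_dvd2)
    have "k * i \<ge> 0" using c ab(2) by (simp flip: i)
    then have "i \<ge> 0" using kpos by (simp add: zero_le_mult_iff)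
    have "h = of_int (c * b) / of_int (b * d)" using ab(2) cd(2) unfolding cd(1) by simp
    then have "h = of_int i * e" unfolding i e_def by simp
    also have "\<dots> = of_nat (nat i) * e" using \<open>i \<ge> 0\<close> by simp
    finally show ?thesis by blast
  qed
  ultimately show thesis using that by blast
qed

definition adjoin :: "rat set \<Rightarrow> rat \<Rightarrow> rat set" where
  "adjoin M w = {m + of_nat j * w | m j. m \<in> M}"

lemma subset_adjoin: "M \<subseteq> adjoin M w"
proof
  fix m assume "m \<in> M"
  moreover have "m = m + of_nat 0 * w" by simp
  ultimately show "m \<in> adjoin M w" unfolding adjoin_def by blast
qed

lemma mem_adjoin:
  assumes "0 \<in> M"
  shows "w \<in> adjoin M w"
proof -
  have "w = 0 + of_nat 1 * w" by simp
  then show ?thesis using assms unfolding adjoin_def by blast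
qed

definition discrete_cone :: "rat set \<Rightarrow> rat set \<Rightarrow> bool" where
  "discrete_cone G M \<longleftrightarrow> 0 \<in> M \<and> (\<forall>x\<in>M. \<forall>y\<in>M. x + y \<in> M) \<and>
     (\<exists>g\<in>G. g > 0 \<and> M \<subseteq> range (\<lambda>k. of_nat k * g))"

lemma discrete_cone_mult_nat:
  assumes "discrete_cone G M" "x \<in> M"
  shows "of_nat n * x \<in> M"
  using assms by (induction n) (auto simp: discrete_cone_def distrib_right)

lemma discrete_cone_nonneg:
  assumes "discrete_cone G M" "x \<in> M"
  shows "x \<ge> 0"
  using assms unfolding discrete_cone_def by fastforce

lemma discrete_cone_subset:
  assumes "subgroup_rat G" "discrete_cone G M"
  shows "M \<subseteq> G"
  using assms subgroup_rat_mult_nat unfolding discrete_cone_def by blast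

lemma discrete_cone_finite_below:
  assumes "discrete_cone G M"
  shows "finite {x \<in> M. x \<le> b}"
proof -
  obtain g where g: "g > 0" "M \<subseteq> range (\<lambda>k. of_nat k * g)"
    using assms unfolding discrete_cone_def by blast
  have "{x \<in> M. x \<le> b} \<subseteq> (\<lambda>k. of_nat k * g) ` {..nat \<lceil>b / g\<rceil>}"
  proof
    fix x assume x: "x \<in> {x \<in> M. x \<le> b}"
    then obtain k where k: "x = of_nat k * g" using g by blast
    with x g have "of_nat k \<le> b / g" by (simp add: field_simps)
    then have "k \<le> nat \<lceil>b / g\<rceil>"
      by (metis ceiling_mono ceiling_of_nat nat_int nat_mono)
    then show "x \<in> (\<lambda>k. of_nat k * g) ` {..nat \<lceil>b / g\<rceil>}" using k by blast
  qed
  then show ?thesis using finite_surj by blast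
qed

lemma discrete_cone_adjoin:
  assumes G: "subgroup_rat G" and M: "discrete_cone G M" and w: "w \<in> G" "w \<ge> 0"
  shows "discrete_cone G (adjoin M w)"
proof -
  obtain g where g: "g \<in> G" "g > 0" "M \<subseteq> range (\<lambda>k. of_nat k * g)"
    using M unfolding discrete_cone_def by blast
  obtain e i j where e: "e \<in> G" "e > 0" "g = of_nat i * e" "w = of_nat j * e"
    using subgroup_rat_common_generator[OF G g(1,2) w] by metis
  have "adjoin M w \<subseteq> range (\<lambda>k. of_nat k * e)"
  proof
    fix x assume "x \<in> adjoin M w"
    then obtain m l where ml: "m \<in> M" "x = m + of_nat l * w" unfolding adjoin_def by blast
    obtain k where "m = of_nat k * g" using ml g by blast
    then have "x = of_nat (k * i + l * j) * e"
      using ml e by (simp add: algebra_simps)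
    then show "x \<in> range (\<lambda>k. of_nat k * e)" by blast
  qed
  moreover have "0 \<in> adjoin M w"
    using M subset_adjoin unfolding discrete_cone_def by blast
  moreover have "x + y \<in> adjoin M w" if xy: "x \<in> adjoin M w" "y \<in> adjoin M w" for x y
  proof -
    obtain m l m' l' where "m \<in> M" "x = m + of_nat l * w" "m' \<in> M" "y = m' + of_nat l' * w"
      using xy unfolding adjoin_def by blast
    then have "x + y = (m + m') + of_nat (l + l') * w" "m + m' \<in> M"
      using M by (auto simp: algebra_simps discrete_cone_def)
    then show ?thesis unfolding adjoin_def by blast
  qed
  ultimately show ?thesis using e unfolding discrete_cone_def by blast
qed

text \<open>The component d q is the current term of the sequence generating the interval for q; all q are
treated at once, and finite support leaves only finitely many positive forbidden elements.\<close>

definition stage :: "rat set \<Rightarrow> rat \<Rightarrow> rat set \<Rightarrow> (nat \<Rightarrow> rat) \<Rightarrow> bool" where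
  "stage G u M d \<longleftrightarrow> discrete_cone G M \<and> u \<in> M \<and> range d \<subseteq> M \<and> finite {q. d q \<noteq> 0} \<and>
     (\<forall>q t. 1 \<le> t \<and> t < q \<longrightarrow> of_nat t * d q - u \<notin> M)"

definition extends :: "rat set \<Rightarrow> (nat \<Rightarrow> rat) \<Rightarrow> rat set \<Rightarrow> (nat \<Rightarrow> rat) \<Rightarrow> bool" where
  "extends M d M' d' \<longleftrightarrow> M \<subseteq> M' \<and> (\<forall>q. d' q - d q \<in> M')"

lemma extends_trans:
  assumes "extends M d M' d'" "extends M' d' M'' d''" "discrete_cone G M''"
  shows "extends M d M'' d''"
proof -
  have "d'' q - d q \<in> M''" for q
  proof -
    have "(d'' q - d' q) + (d' q - d q) \<in> M''"
      using assms unfolding extends_def discrete_cone_def by blast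
    then show ?thesis by simp
  qed
  then show ?thesis using assms unfolding extends_def by blast
qed

lemma stage_bound:
  assumes "stage G u M d"
  obtains C where "\<And>q. of_nat q * d q \<le> C" "C \<ge> 0"
proof -
  define S where "S = (\<lambda>q. of_nat q * d q) ` {q. d q \<noteq> 0}"
  have fin: "finite S" using assms unfolding stage_def S_def by simp
  have "of_nat q * d q \<le> Max (insert 0 S)" for q
  proof (cases "d q = 0")
    case True
    then show ?thesis using fin by simp
  next
    case False
    then have "of_nat q * d q \<in> insert 0 S" unfolding S_def by blast
    then show ?thesis using fin by (meson Max_ge finite_insert)
  qed
  moreover have "Max (insert 0 S) \<ge> 0" using fin by simp
  ultimately show thesis using that by blast
qed

lemma stage_target_le:
  assumes "stage G u M d" "t < q"
  shows "of_nat t * d q \<le> of_nat q * d q"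
proof -
  have "d q \<ge> 0" using assms discrete_cone_nonneg unfolding stage_def by blast
  then show ?thesis using assms by (intro mult_right_mono) auto
qed

locale finely_divisible =
  fixes G :: "rat set"
  assumes subgroup: "subgroup_rat G"
    and ex_pos: "\<exists>g\<in>G. g > 0"
    and divisible: "\<And>g N. g \<in> G \<Longrightarrow> g > 0 \<Longrightarrow> \<exists>h\<in>G. \<exists>K\<ge>N. g = of_nat K * h"
begin

lemma ex_between:
  assumes "lo < (hi :: rat)"
  shows "\<exists>t\<in>G. lo < t \<and> t < hi"
proof -
  obtain g where g: "g \<in> G" "g > 0" using ex_pos by blast
  obtain N :: nat where N: "of_nat N > g / (hi - lo)" using reals_Archimedean2 by blast
  obtain h K where h: "h \<in> G" "K \<ge> N" "g = of_nat K * h" using divisible[OF g] by blast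
  have hpos: "h > 0" using g h by (simp add: zero_less_mult_iff)
  have "of_nat N * (hi - lo) > g" using N assms by (simp add: field_simps)
  moreover have "of_nat N * (hi - lo) \<le> of_nat K * (hi - lo)"
    using h assms by (intro mult_right_mono) auto
  ultimately have "of_nat K * h < of_nat K * (hi - lo)" using h by linarith
  then have hlt: "h < hi - lo" by (metis mult_less_cancel_left_pos of_nat_0_le_iff mult_less_cancel_left not_le)
  define t where "t = of_int (\<lfloor>lo / h\<rfloor> + 1) * h"
  have "lo / h < of_int (\<lfloor>lo / h\<rfloor> + 1)" by linarith
  then have "lo < t" using hpos by (simp add: t_def field_simps)
  moreover have "of_int \<lfloor>lo / h\<rfloor> * h \<le> lo"
    using hpos mult_right_mono[OF of_int_floor_le[of "lo / h"], of h] by simp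
  then have "t < hi" using hlt by (simp add: t_def algebra_simps)
  moreover have "t \<in> G" unfolding t_def using subgroup_rat_mult_int[OF subgroup h(1)] .
  ultimately show ?thesis by blast
qed

lemma ex_between_avoiding:
  assumes "lo < (hi :: rat)" "finite B"
  shows "\<exists>t\<in>G. lo < t \<and> t < hi \<and> t \<notin> B"
proof -
  define h where "h = Min (insert hi {b \<in> B. b > lo})"
  have fin: "finite (insert hi {b \<in> B. b > lo})" using assms by simp
  have "h > lo" using assms fin unfolding h_def by (subst Min_gr_iff) auto
  then obtain t where t: "t \<in> G" "lo < t" "t < h" using ex_between by blast
  have "t < b" if "b \<in> insert hi {b \<in> B. b > lo}" for b
    using t fin that unfolding h_def by (meson Min_le less_le_trans)
  then show ?thesis using t by fastforce
qed

lemma stage_order_unit_step: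
  assumes st: "stage G u M d" and v: "v \<in> M" "v \<noteq> 0" and x: "x \<in> G" and u: "u > 0"
  shows "\<exists>M'. stage G u M' d \<and> extends M d M' d \<and> (\<exists>n. of_nat n * v - x \<in> M')"
proof -
  have dc: "discrete_cone G M" using st unfolding stage_def by blast
  obtain C where C: "\<And>q. of_nat q * d q \<le> C" "C \<ge> 0" using stage_bound[OF st] by blast
  have vpos: "v > 0" using v discrete_cone_nonneg[OF dc] by force
  obtain n :: nat where n: "of_nat n > (C + x) / v" using reals_Archimedean2 by blast
  define w where "w = of_nat n * v - x"
  have wC: "w > C" using n vpos by (simp add: w_def field_simps)
  have "v \<in> G" using v discrete_cone_subset[OF subgroup dc] by blast
  then have wG: "w \<in> G" unfolding w_def
    using subgroup_rat_diff subgroup_rat_mult_nat subgroup x by blast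
  define M' where "M' = adjoin M w"
  have dc': "discrete_cone G M'"
    unfolding M'_def using discrete_cone_adjoin[OF subgroup dc wG] wC C by linarith
  have sub: "M \<subseteq> M'" unfolding M'_def by (rule subset_adjoin)
  have "of_nat t * d q - u \<notin> M'" if t: "1 \<le> t" "t < q" for q t
  proof
    assume "of_nat t * d q - u \<in> M'"
    then obtain m j where mj: "m \<in> M" "of_nat t * d q - u = m + of_nat j * w"
      unfolding M'_def adjoin_def by blast
    show False
    proof (cases j)
      case 0
      then show False using mj st t unfolding stage_def by auto
    next
      case (Suc k)
      have "of_nat j * w \<ge> w" using Suc wC C by (simp add: distrib_right)
      moreover have "m \<ge> 0" using mj discrete_cone_nonneg[OF dc] by blast
      ultimately show False using mj wC C(1)[of q] stage_target_le[OF st t(2)] u by linarith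
    qed
  qed
  then have "stage G u M' d" using st dc' sub unfolding stage_def by blast
  moreover have "extends M d M' d" using sub dc' unfolding extends_def discrete_cone_def by simp
  moreover have "w \<in> M'" unfolding M'_def using dc mem_adjoin unfolding discrete_cone_def by blast
  ultimately show ?thesis unfolding w_def by blast
qed

lemma stage_interval_step:
  assumes st: "stage G u M d" and x: "x \<in> M" and q: "q \<ge> 1" and u: "u > 0"
  shows "\<exists>M' d'. stage G u M' d' \<and> extends M d M' d' \<and> of_nat q * d' q - x \<in> M'"
proof -
  have dc: "discrete_cone G M" using st unfolding stage_def by blast
  obtain C where C: "\<And>q. of_nat q * d q \<le> C" "C \<ge> 0" using stage_bound[OF st] by blast
  obtain g where g: "g \<in> G" "g > 0" "M \<subseteq> range (\<lambda>k. of_nat k * g)"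
    using dc unfolding discrete_cone_def by blast
  obtain h K where h: "h \<in> G" "K \<ge> q" "g = of_nat K * h" using divisible[OF g(1,2)] by blast
  have hpos: "h > 0" using g h by (simp add: zero_less_mult_iff)
  define d0 where "d0 = d q"
  have d0: "d0 \<in> M" using st unfolding stage_def d0_def by blast
  have d0x: "d0 \<ge> 0" "x \<ge> 0" using d0 x discrete_cone_nonneg[OF dc] by blast+
  obtain L :: nat where L: "of_nat L > (C + d0 + x) / g" using reals_Archimedean2 by blast
  define e where "e = h + of_nat L * g"
  have e: "e > C + d0 + x" using L hpos g by (simp add: e_def field_simps)
  have eG: "e \<in> G" unfolding e_def
    using subgroup g h subgroup_rat_mult_nat unfolding subgroup_rat_def by blast
  have order: "of_nat s * e \<noteq> of_int k * g" if s: "1 \<le> s" "s < q" for s k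
  proof
    assume "of_nat s * e = of_int k * g"
    then have "(of_nat s) * h = (of_int (k - int s * int L) * of_nat K) * h"
      unfolding e_def h(3) by (simp add: algebra_simps)
    then have "(of_nat s :: rat) = of_int (k - int s * int L) * of_nat K" using hpos by simp
    then have "int s = (k - int s * int L) * int K"
      by (metis of_int_eq_iff of_int_mult of_int_of_nat_eq)
    then have "int K dvd int s" by (metis dvd_triv_right)
    then have "K dvd s" by simp
    then show False using s h(2) dvd_imp_le[of K s] by linarith
  qed
  have MG: "M \<subseteq> G" using discrete_cone_subset[OF subgroup dc] .
  define w1 where "w1 = e - d0"
  define w2 where "w2 = of_nat q * e - x"
  define M1 where "M1 = adjoin M w1"
  define M' where "M' = adjoin M1 w2"
  define d' where "d' = d(q := e)"
  have w1C: "w1 > C" using e d0x by (simp add: w1_def)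
  have "e \<ge> 0" using e C d0x by linarith
  then have "of_nat q * e \<ge> e" using q mult_right_mono[of 1 "of_nat q" e] by simp
  then have w2C: "w2 > C" using e d0x by (simp add: w2_def)
  have w1G: "w1 \<in> G" and w2G: "w2 \<in> G" unfolding w1_def w2_def
    using subgroup_rat_diff subgroup_rat_mult_nat subgroup eG x d0 MG by blast+
  have dc1: "discrete_cone G M1" unfolding M1_def
    using discrete_cone_adjoin[OF subgroup dc w1G] w1C C by linarith
  have dc': "discrete_cone G M'" unfolding M'_def
    using discrete_cone_adjoin[OF subgroup dc1 w2G] w2C C by linarith
  have sub: "M \<subseteq> M1" "M1 \<subseteq> M'" unfolding M1_def M'_def by (rule subset_adjoin)+
  have w1M: "w1 \<in> M'" using sub mem_adjoin[of M w1] dc unfolding M1_def discrete_cone_def by blast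
  have w2M: "w2 \<in> M'" using mem_adjoin[of M1 w2] dc1 unfolding M'_def discrete_cone_def by blast
  have eM: "e \<in> M'"
  proof -
    have "d0 + w1 \<in> M'" using d0 sub w1M dc' unfolding discrete_cone_def by blast
    then show ?thesis by (simp add: w1_def)
  qed
  have "of_nat t * d' p - u \<notin> M'" if t: "1 \<le> t" "t < p" for p t
  proof
    assume "of_nat t * d' p - u \<in> M'"
    then obtain m i j where mij: "m \<in> M" "of_nat t * d' p - u = m + of_nat i * w1 + of_nat j * w2"
      unfolding M'_def M1_def adjoin_def by blast
    have m0: "m \<ge> 0" using mij discrete_cone_nonneg[OF dc] by blast
    have i0: "of_nat i * w1 \<ge> 0" and j0: "of_nat j * w2 \<ge> 0" using w1C w2C C by simp_all
    have j1: "of_nat j * w2 \<ge> w2" if "j \<noteq> 0"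
      using that w2C C mult_right_mono[of 1 "of_nat j" w2] by simp
    show False
    proof (cases "p = q")
      case False
      then have d'p: "d' p = d p" by (simp add: d'_def)
      have i1: "of_nat i * w1 \<ge> w1" if "i \<noteq> 0"
        using that w1C C mult_right_mono[of 1 "of_nat i" w1] by simp
      have "m + of_nat i * w1 + of_nat j * w2 < C"
        using mij(2) d'p C(1)[of p] stage_target_le[OF st t(2)] u by simp
      then have "i = 0" "j = 0"
        using i1 j1 m0 i0 j0 w1C w2C by linarith+
      then show False using mij st t d'p unfolding stage_def by auto
    next
      case True
      then have d'p: "d' p = e" by (simp add: d'_def)
      have tq: "t < q" using t True by simp
      have te: "of_nat t * e \<le> (of_nat q - 1) * e"
        using tq \<open>e \<ge> 0\<close> by (intro mult_right_mono) (auto simp: of_nat_diff[symmetric] simp flip: of_nat_Suc)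
      have "w2 > (of_nat q - 1) * e" using e C d0x by (simp add: w2_def algebra_simps)
      then have j: "j = 0"
        using j1 m0 i0 mij(2) te u unfolding d'p by linarith
      have "i \<le> t"
      proof (rule ccontr)
        assume "\<not> i \<le> t"
        then have "Suc t \<le> i" by simp
        then have "of_nat (Suc t) * w1 \<le> of_nat i * w1"
          using w1C C by (intro mult_right_mono) (auto simp del: of_nat_Suc)
        moreover have "of_nat (Suc t) * d0 \<le> of_nat q * d0"
          using tq d0x by (intro mult_right_mono) (auto simp del: of_nat_Suc)
        then have "of_nat (Suc t) * d0 \<le> e" using C(1)[of q] e d0x unfolding d0_def by linarith
        then have "of_nat t * e \<le> of_nat (Suc t) * w1" by (simp add: w1_def algebra_simps)
        ultimately show False using mij(2) d'p j m0 u by simp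
      qed
      show False
      proof (cases "i = t")
        case True
        then have "of_nat t * d q - u = m"
          using mij(2) d'p j by (simp add: w1_def d0_def algebra_simps)
        then show False using mij st tq t unfolding stage_def by auto
      next
        case False
        with \<open>i \<le> t\<close> have it: "i < t" by simp
        have "u \<in> M" using st unfolding stage_def by blast
        then have "m \<in> range (\<lambda>k. of_nat k * g)" "u \<in> range (\<lambda>k. of_nat k * g)"
          "d0 \<in> range (\<lambda>k. of_nat k * g)"
          using g(3) mij(1) d0 by blast+
        then obtain a b c where abc: "m = of_nat a * g" "u = of_nat b * g" "d0 = of_nat c * g"
          by (elim rangeE)
        have "of_nat (t - i) * e = m + u - of_nat i * d0"
          using mij(2) d'p j it by (simp add: w1_def of_nat_diff algebra_simps)
        also have "\<dots> = of_int (int a + int b - int i * int c) * g"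
          using abc by (simp add: algebra_simps)
        finally have "of_nat (t - i) * e = of_int (int a + int b - int i * int c) * g" .
        moreover have "1 \<le> t - i" "t - i < q" using it tq by simp_all
        ultimately show False using order by blast
      qed
    qed
  qed
  moreover have "range d' \<subseteq> M'" 
  proof -
    have "d p \<in> M'" for p using st sub unfolding stage_def by blast
    then show ?thesis using eM by (auto simp: d'_def)
  qed
  moreover have "finite {p. d' p \<noteq> 0}"
  proof (rule finite_subset)
    show "{p. d' p \<noteq> 0} \<subseteq> insert q {p. d p \<noteq> 0}" by (auto simp: d'_def)
    show "finite (insert q {p. d p \<noteq> 0})" using st by (simp add: stage_def)
  qed
  ultimately have "stage G u M' d'" using st sub dc' unfolding stage_def by blast
  moreover have "extends M d M' d'"
    using sub w1M dc' unfolding extends_def d'_def w1_def d0_def discrete_cone_def by auto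
  moreover have "of_nat q * d' q - x \<in> M'" using w2M by (simp add: d'_def w2_def)
  ultimately show ?thesis by blast
qed

lemma stage_refinement_step_pos:
  assumes st: "stage G u M d" and u: "u > 0"
    and mem: "x1 \<in> M" "x2 \<in> M" "y1 \<in> M" "y2 \<in> M" and eq: "x1 + x2 = y1 + y2"
    and pos: "x1 > 0" "x2 > 0" "y1 > 0" "y2 > 0"
  shows "\<exists>M'. stage G u M' d \<and> extends M d M' d \<and>
    (\<exists>t\<in>M'. x1 - t \<in> M' \<and> y1 - t \<in> M' \<and> x2 - y1 + t \<in> M')"
proof -
  have dc: "discrete_cone G M" using st unfolding stage_def by blast
  have MG: "M \<subseteq> G" using discrete_cone_subset[OF subgroup dc] .
  obtain C where C: "\<And>q. of_nat q * d q \<le> C" "C \<ge> 0" using stage_bound[OF st] by blast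
  define lo where "lo = max 0 (x1 - y2)"
  define hi where "hi = min x1 y1"
  have lohi: "lo < hi" using pos eq by (auto simp: lo_def hi_def)
  define \<epsilon> where "\<epsilon> = (hi - lo) / 3"
  have \<epsilon>: "\<epsilon> > 0" using lohi by (simp add: \<epsilon>_def)
  have "lo + \<epsilon> < hi - \<epsilon>" using lohi by (simp add: \<epsilon>_def field_simps)
  define N where "N = nat \<lceil>C / \<epsilon>\<rceil>"
  define F where "F = (\<Union>q\<in>{q. d q \<noteq> 0}. (\<lambda>s. of_nat s * d q - u) ` {..<q})"
  have finF: "finite F" using st unfolding F_def stage_def by blast
  define bad where "bad = (\<lambda>(f, m, i, j, k, l). (f - m - of_nat j * x1 - of_nat k * y1 - of_nat l * (x2 - y1)) /
      (of_nat i + of_nat l - of_nat j - of_nat k)) `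
      (F \<times> {m \<in> M. m \<le> C} \<times> {..N} \<times> {..N} \<times> {..N} \<times> {..N})"
  have "finite bad"
    unfolding bad_def using finF discrete_cone_finite_below[OF dc] by (intro finite_imageI finite_cartesian_product) auto
  then obtain t where t: "t \<in> G" "lo + \<epsilon> < t" "t < hi - \<epsilon>" "t \<notin> bad"
    using ex_between_avoiding[OF \<open>lo + \<epsilon> < hi - \<epsilon>\<close>] by blast
  define z where "z = x2 - y1 + t"
  have big: "t \<ge> \<epsilon>" "x1 - t \<ge> \<epsilon>" "y1 - t \<ge> \<epsilon>" "z \<ge> \<epsilon>"
    using t eq by (auto simp: lo_def hi_def z_def)
  define M1 where "M1 = adjoin M t"
  define M2 where "M2 = adjoin M1 (x1 - t)"
  define M3 where "M3 = adjoin M2 (y1 - t)"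
  define M' where "M' = adjoin M3 z"
  have inG: "x1 - t \<in> G" "y1 - t \<in> G" "x2 - y1 \<in> G"
    using subgroup_rat_diff[OF subgroup] mem MG t by blast+
  then have zG: "z \<in> G" using subgroup t unfolding z_def subgroup_rat_def by blast
  have dc1: "discrete_cone G M1" unfolding M1_def
    using discrete_cone_adjoin[OF subgroup dc t(1)] big \<epsilon> by linarith
  have dc2: "discrete_cone G M2" unfolding M2_def
    using discrete_cone_adjoin[OF subgroup dc1 inG(1)] big \<epsilon> by linarith
  have dc3: "discrete_cone G M3" unfolding M3_def
    using discrete_cone_adjoin[OF subgroup dc2 inG(2)] big \<epsilon> by linarith
  have dc': "discrete_cone G M'" unfolding M'_def
    using discrete_cone_adjoin[OF subgroup dc3 zG] big \<epsilon> by linarith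
  have sub: "M \<subseteq> M1" "M1 \<subseteq> M2" "M2 \<subseteq> M3" "M3 \<subseteq> M'"
    unfolding M1_def M2_def M3_def M'_def by (rule subset_adjoin)+
  have "t \<in> M1" "x1 - t \<in> M2" "y1 - t \<in> M3" "z \<in> M'"
    using mem_adjoin dc dc1 dc2 dc3 unfolding discrete_cone_def M1_def M2_def M3_def M'_def by blast+
  then have entries: "t \<in> M'" "x1 - t \<in> M'" "y1 - t \<in> M'" "z \<in> M'" using sub by blast+
  have "of_nat s * d q - u \<notin> M'" if s: "1 \<le> s" "s < q" for q s
  proof
    define f where "f = of_nat s * d q - u"
    assume "of_nat s * d q - u \<in> M'"
    then obtain m i j k l where m: "m \<in> M"
      and f: "f = m + of_nat i * t + of_nat j * (x1 - t) + of_nat k * (y1 - t) + of_nat l * z"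
      unfolding M'_def M3_def M2_def M1_def adjoin_def f_def by blast
    have m0: "m \<ge> 0" using m discrete_cone_nonneg[OF dc] by blast
    have nn: "of_nat i * t \<ge> 0" "of_nat j * (x1 - t) \<ge> 0" "of_nat k * (y1 - t) \<ge> 0" "of_nat l * z \<ge> 0"
      using big \<epsilon> by simp_all
    have fC: "f \<le> C" using C(1)[of q] stage_target_le[OF st s(2)] u unfolding f_def by linarith
    have small: "n \<le> N" if "of_nat n * w \<le> C" "w \<ge> \<epsilon>" for n w
    proof -
      have "of_nat n * \<epsilon> \<le> C" using that mult_left_mono[of \<epsilon> w "of_nat n"] by simp
      then have "of_nat n \<le> C / \<epsilon>" using \<epsilon> by (simp add: field_simps)
      then have "int n \<le> \<lceil>C / \<epsilon>\<rceil>" by (metis ceiling_mono ceiling_of_nat)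
      then show ?thesis unfolding N_def by linarith
    qed
    have "of_nat i * t \<le> C" "of_nat j * (x1 - t) \<le> C" "of_nat k * (y1 - t) \<le> C" "of_nat l * z \<le> C"
      using m0 nn f fC by linarith+
    then have ijkl: "i \<le> N" "j \<le> N" "k \<le> N" "l \<le> N"
      using small big by blast+
    have mC: "m \<le> C" using m0 nn f fC by linarith
    have "d q \<noteq> 0"
    proof
      assume "d q = 0"
      then have "f < 0" using u by (simp add: f_def)
      then show False using m0 nn f by linarith
    qed
    then have fF: "f \<in> F" unfolding F_def f_def using s by blast
    show False
    proof (cases "i + l = j + k")
      case False
      define c :: rat where "c = of_nat i + of_nat l - of_nat j - of_nat k"
      have c0: "c \<noteq> 0"
      proof
        assume "c = 0"
        then have "(of_nat (i + l) :: rat) = of_nat (j + k)" by (simp add: c_def)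
        then show False using False of_nat_eq_iff by blast
      qed
      have "f - m - of_nat j * x1 - of_nat k * y1 - of_nat l * (x2 - y1) = c * t"
        unfolding f z_def c_def by (simp add: algebra_simps)
      then have "t = (f - m - of_nat j * x1 - of_nat k * y1 - of_nat l * (x2 - y1)) / c"
        using c0 by (simp add: field_simps)
      then have "t \<in> bad" unfolding bad_def c_def
        using fF m mC ijkl by (intro image_eqI[of _ _ "(f, m, i, j, k, l)"]) auto
      then show False using t by blast
    next
      case True
      have cl: "\<And>x y. x \<in> M \<Longrightarrow> y \<in> M \<Longrightarrow> x + y \<in> M" using dc unfolding discrete_cone_def by blast
      note ml = discrete_cone_mult_nat[OF dc]
      have "f \<in> M"
      proof (cases "j \<le> i")
        case ji: True
        then obtain r where r: "i = j + r" using le_Suc_ex by blast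
        then have k: "k = l + r" using True by simp
        have "f = m + of_nat j * x1 + of_nat r * y1 + of_nat l * x2"
          unfolding f r k z_def by (simp add: algebra_simps)
        then show ?thesis using m mem cl ml by simp
      next
        case False
        then obtain r where r: "j = i + r" using le_Suc_ex nat_le_linear by blast
        then have l: "l = k + r" using True by simp
        have y2: "y2 = x1 + x2 - y1" using eq by simp
        have "f = m + of_nat i * x1 + of_nat r * y2 + of_nat k * x2"
          unfolding f r l z_def y2 by (simp add: algebra_simps)
        then show ?thesis using m mem cl ml by simp
      qed
      then show False using st s unfolding stage_def f_def by blast
    qed
  qed
  moreover have "M \<subseteq> M'" using sub by blast
  ultimately have "stage G u M' d" using st dc' unfolding stage_def by blast
  moreover have "extends M d M' d" using \<open>M \<subseteq> M'\<close> dc' unfolding extends_def discrete_cone_def by simp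
  ultimately show ?thesis using entries unfolding z_def by blast
qed

lemma stage_refinement_step:
  assumes st: "stage G u M d" and u: "u > 0"
    and mem: "x1 \<in> M" "x2 \<in> M" "y1 \<in> M" "y2 \<in> M" and eq: "x1 + x2 = y1 + y2"
  shows "\<exists>M'. stage G u M' d \<and> extends M d M' d \<and>
    (\<exists>t\<in>M'. x1 - t \<in> M' \<and> y1 - t \<in> M' \<and> x2 - y1 + t \<in> M')"
proof (cases "x1 = 0 \<or> x2 = 0 \<or> y1 = 0 \<or> y2 = 0")
  case True
  have dc: "discrete_cone G M" using st unfolding stage_def by blast
  have 0: "0 \<in> M" using dc unfolding discrete_cone_def by blast
  have "\<exists>t\<in>M. x1 - t \<in> M \<and> y1 - t \<in> M \<and> x2 - y1 + t \<in> M"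
    using True
  proof (elim disjE)
    assume "x1 = 0"
    then show ?thesis using 0 mem eq by (intro bexI[of _ 0]) auto
  next
    assume "x2 = 0"
    then show ?thesis using 0 mem eq by (intro bexI[of _ y1]) auto
  next
    assume "y1 = 0"
    then show ?thesis using 0 mem eq by (intro bexI[of _ 0]) auto
  next
    assume "y2 = 0"
    then have "x2 = y1 - x1" using eq by simp
    then show ?thesis using 0 mem by (intro bexI[of _ x1]) auto
  qed
  moreover have "extends M d M d" using 0 unfolding extends_def by simp
  ultimately show ?thesis using st by blast
next
  case False
  have dc: "discrete_cone G M" using st unfolding stage_def by blast
  have "x1 > 0" "x2 > 0" "y1 > 0" "y2 > 0"
    using False mem discrete_cone_nonneg[OF dc] by force+
  then show ?thesis using stage_refinement_step_pos[OF st u mem eq] by blast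
qed

definition handles :: "rat \<Rightarrow> rat \<Rightarrow> rat \<Rightarrow> rat \<Rightarrow> nat \<Rightarrow> rat set \<Rightarrow> rat set \<Rightarrow> (nat \<Rightarrow> rat) \<Rightarrow> bool"
  where "handles w x y z q M M' d \<longleftrightarrow>
    (w \<in> M \<and> x \<in> M \<and> y \<in> M \<and> z \<in> M \<and> w + x = y + z \<longrightarrow>
      (\<exists>t\<in>M'. w - t \<in> M' \<and> y - t \<in> M' \<and> x - y + t \<in> M')) \<and>
    (w \<in> M \<and> w \<noteq> 0 \<and> x \<in> G \<longrightarrow> (\<exists>n. of_nat n * w - x \<in> M')) \<and>
    (w \<in> M \<and> q \<ge> 1 \<longrightarrow> of_nat q * d q - w \<in> M')"

lemma stage_step:
  assumes st: "stage G u M d" and u: "u > 0"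
  shows "\<exists>M' d'. stage G u M' d' \<and> extends M d M' d' \<and> handles w x y z q M M' d'"
proof -
  have refl: "extends M d M d" if "stage G u M d" for M d
    using that unfolding stage_def discrete_cone_def extends_def by auto
  obtain M1 where M1: "stage G u M1 d" "extends M d M1 d"
    "w \<in> M \<and> x \<in> M \<and> y \<in> M \<and> z \<in> M \<and> w + x = y + z \<longrightarrow>
      (\<exists>t\<in>M1. w - t \<in> M1 \<and> y - t \<in> M1 \<and> x - y + t \<in> M1)"
    using stage_refinement_step[OF st u, of w x y z] st refl[OF st] by metis
  obtain M2 where M2: "stage G u M2 d" "extends M1 d M2 d"
    "w \<in> M1 \<and> w \<noteq> 0 \<and> x \<in> G \<longrightarrow> (\<exists>n. of_nat n * w - x \<in> M2)"
    using stage_order_unit_step[OF M1(1) _ _ _ u, of w x] M1(1) refl[OF M1(1)] by metis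
  obtain M3 d3 where M3: "stage G u M3 d3" "extends M2 d M3 d3"
    "w \<in> M2 \<and> q \<ge> 1 \<longrightarrow> of_nat q * d3 q - w \<in> M3"
    using stage_interval_step[OF M2(1) _ _ u, of w q] M2(1) refl[OF M2(1)] by metis
  have sub: "M \<subseteq> M1" "M1 \<subseteq> M2" "M2 \<subseteq> M3" using M1 M2 M3 unfolding extends_def by blast+
  have "handles w x y z q M M3 d3"
    using M1(3) M2(3) M3(3) sub unfolding handles_def by blast
  moreover have "discrete_cone G M2" "discrete_cone G M3"
    using M2 M3 unfolding stage_def by blast+
  then have "extends M d M3 d3"
    using extends_trans[OF extends_trans[OF M1(2) M2(2)] M3(2)] by blast
  ultimately show ?thesis using M3(1) by blast
qed

lemma ex_stage_chain:
  obtains u M d where "u > 0"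
    "\<And>k. stage G u (M k) (d k)"
    "\<And>k. extends (M k) (d k) (M (Suc k)) (d (Suc k))"
    "\<And>w x y z q k0. \<exists>k\<ge>k0. handles w x y z q (M k) (M (Suc k)) (d (Suc k))"
proof -
  obtain u where u: "u \<in> G" "u > 0" using ex_pos by blast
  \<comment> \<open>The ignored second component of the pairing makes every task recur infinitely often, so it is
    met again after its arguments have entered the chain.\<close>
  define task :: "nat \<Rightarrow> rat \<times> rat \<times> rat \<times> rat \<times> nat"
    where "task k = from_nat (fst (prod_decode k))" for k
  define P where "P = (\<lambda>(k::nat) s. stage G u (fst s) (snd s))"
  define Q where "Q = (\<lambda>k s s'. extends (fst s) (snd s) (fst s') (snd s') \<and>
    (case task k of (w, x, y, z, q) \<Rightarrow> handles w x y z q (fst s) (fst s') (snd s')))"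
  have "stage G u (range (\<lambda>k. of_nat k * u)) (\<lambda>_. 0)"
  proof -
    have "0 \<in> range (\<lambda>k. of_nat k * u)" by (intro range_eqI[of _ _ 0]) simp
    moreover have "u \<in> range (\<lambda>k. of_nat k * u)" by (intro range_eqI[of _ _ 1]) simp
    moreover have "of_nat k * u + of_nat l * u = of_nat (k + l) * u" for k l
      by (simp add: distrib_right)
    then have "of_nat k * u + of_nat l * u \<in> range (\<lambda>k. of_nat k * u)" for k l
      by (metis rangeI)
    moreover have "- u \<noteq> of_nat k * u" for k
      using u mult_nonneg_nonneg[of "of_nat k" u] by (metis less_imp_le neg_0_le_iff_le not_le of_nat_0_le_iff)
    then have "- u \<notin> range (\<lambda>k. of_nat k * u)" by blast
    ultimately show ?thesis using u unfolding stage_def discrete_cone_def by auto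
  qed
  then have "\<exists>s. P 0 s" unfolding P_def by auto
  moreover have "\<exists>s'. P (Suc k) s' \<and> Q k s s'" if "P k s" for s k
  proof -
    obtain w x y z q where t: "task k = (w, x, y, z, q)" by (metis prod_cases5)
    show ?thesis
      using stage_step[of u "fst s" "snd s" w x y z q] that u
      unfolding P_def Q_def t by auto
  qed
  ultimately obtain S where S: "\<And>k. P k (S k)" "\<And>k. Q k (S k) (S (Suc k))"
    using dependent_nat_choice[of P Q] by metis
  have "\<exists>k\<ge>k0. handles w x y z q (fst (S k)) (fst (S (Suc k))) (snd (S (Suc k)))" for w x y z q k0
  proof -
    define k where "k = prod_encode (to_nat (w, x, y, z, q), k0)"
    have "task k = (w, x, y, z, q)" by (simp add: task_def k_def)
    moreover have "k \<ge> k0" unfolding k_def by (rule le_prod_encode_2)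
    ultimately show ?thesis using S(2)[of k] unfolding Q_def by auto
  qed
  then show thesis using that[of u "\<lambda>k. fst (S k)" "\<lambda>k. snd (S k)"] u S
    unfolding P_def Q_def by blast
qed

end

lemma increasing_diff_mem:
  assumes P: "0 \<in> P" "\<And>x y. x \<in> P \<Longrightarrow> y \<in> P \<Longrightarrow> x + y \<in> P"
    and c: "\<And>k. c (Suc k) - c k \<in> P" and "k \<le> (l :: nat)"
  shows "c l - (c k :: rat) \<in> P"
  using \<open>k \<le> l\<close>
proof (induction rule: dec_induct)
  case base
  then show ?case using P by simp
next
  case (step n)
  have "(c n - c k) + (c (Suc n) - c n) \<in> P" using step c P by blast
  then show ?case by simp
qed

definition hereditary_hull :: "rat set \<Rightarrow> (nat \<Rightarrow> rat) \<Rightarrow> rat set" where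
  "hereditary_hull P c = {z \<in> P. \<exists>k. c k - z \<in> P}"

lemma interval_hereditary_hull:
  assumes P: "0 \<in> P" "\<And>x y. x \<in> P \<Longrightarrow> y \<in> P \<Longrightarrow> x + y \<in> P"
    and c: "\<And>k. c k \<in> P" "\<And>k. c (Suc k) - c k \<in> P"
  shows "interval P (hereditary_hull P c)"
proof -
  have mem: "c k \<in> hereditary_hull P c" for k
  proof -
    have "c k - c k \<in> P" using P by simp
    then show ?thesis using c unfolding hereditary_hull_def by blast
  qed
  have "\<exists>z\<in>hereditary_hull P c. z - x \<in> P \<and> z - y \<in> P"
    if xy: "x \<in> hereditary_hull P c" "y \<in> hereditary_hull P c" for x y
  proof -
    obtain k l where kl: "c k - x \<in> P" "c l - y \<in> P" using xy unfolding hereditary_hull_def by blast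
    define n where "n = max k l"
    have "c n - c k \<in> P" "c n - c l \<in> P"
      using increasing_diff_mem[of P c, OF P c(2)] unfolding n_def by auto
    then have "(c n - c k) + (c k - x) \<in> P" "(c n - c l) + (c l - y) \<in> P" using P kl by blast+
    then show ?thesis using mem[of n] by auto
  qed
  moreover have "y \<in> hereditary_hull P c"
    if xy: "x \<in> hereditary_hull P c" "y \<in> P" "x - y \<in> P" for x y
  proof -
    obtain k where "c k - x \<in> P" using xy unfolding hereditary_hull_def by blast
    then have "(c k - x) + (x - y) \<in> P" using P xy by blast
    then have "c k - y \<in> P" by simp
    then show ?thesis using xy unfolding hereditary_hull_def by blast
  qed
  moreover have "hereditary_hull P c \<noteq> {}" using mem by blast
  moreover have "hereditary_hull P c \<subseteq> P" unfolding hereditary_hull_def by blast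
  ultimately show ?thesis unfolding interval_def pleq_def by blast
qed

lemma countably_generated_rat:
  assumes "0 \<in> P"
  shows "countably_generated P X"
proof -
  have "countable X" by simp
  moreover have "x - x \<in> P" for x using assms by simp
  ultimately show ?thesis unfolding countably_generated_def pleq_def by blast
qed

lemma imult_hereditary_hull:
  assumes P: "0 \<in> P" "\<And>x y. x \<in> P \<Longrightarrow> y \<in> P \<Longrightarrow> x + y \<in> P"
    and c: "\<And>k. c k \<in> P" "\<And>k. c (Suc k) - c k \<in> P"
    and t: "t \<ge> 1"
  shows "imult P t (hereditary_hull P c) = hereditary_hull P (\<lambda>k. of_nat t * c k)"
  using t
proof (induction t rule: dec_induct)
  case base
  then show ?case by simp
next
  case (step t)
  have mult: "of_nat n * x \<in> P" if "x \<in> P" for n x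
    using that P by (induction n) (auto simp: distrib_right)
  have "imult P (Suc t) (hereditary_hull P c) =
      isum P (hereditary_hull P (\<lambda>k. of_nat t * c k)) (hereditary_hull P c)"
    using step by (cases t) auto
  also have "\<dots> = hereditary_hull P (\<lambda>k. of_nat (Suc t) * c k)"
  proof (intro equalityI subsetI)
    fix z assume "z \<in> isum P (hereditary_hull P (\<lambda>k. of_nat t * c k)) (hereditary_hull P c)"
    then obtain x y k l where z: "z \<in> P" "x + y - z \<in> P"
      and x: "of_nat t * c k - x \<in> P" and y: "c l - y \<in> P"
      unfolding isum_def hereditary_hull_def pleq_def by blast
    define n where "n = max k l"
    have "c n - c k \<in> P" "c n - c l \<in> P"
      using increasing_diff_mem[of P c, OF P c(2)] unfolding n_def by auto
    then have "of_nat t * (c n - c k) \<in> P" using mult by blast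
    then have "of_nat t * (c n - c k) + (of_nat t * c k - x) \<in> P" using x by (rule P(2))
    moreover have "(c n - c l) + (c l - y) \<in> P" using \<open>c n - c l \<in> P\<close> y by (rule P(2))
    ultimately have "(of_nat t * (c n - c k) + (of_nat t * c k - x)) + ((c n - c l) + (c l - y)) \<in> P"
      by (rule P(2))
    then have "(of_nat t * (c n - c k) + (of_nat t * c k - x)) + ((c n - c l) + (c l - y))
        + (x + y - z) \<in> P" using z(2) by (rule P(2))
    then have "of_nat (Suc t) * c n - z \<in> P" by (simp add: algebra_simps)
    then show "z \<in> hereditary_hull P (\<lambda>k. of_nat (Suc t) * c k)"
      using z unfolding hereditary_hull_def by blast
  next
    fix z assume "z \<in> hereditary_hull P (\<lambda>k. of_nat (Suc t) * c k)"
    then obtain k where z: "z \<in> P" "of_nat (Suc t) * c k - z \<in> P"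
      unfolding hereditary_hull_def by blast
    have "of_nat t * c k - of_nat t * c k \<in> P" "c k - c k \<in> P" using P by simp_all
    then have "of_nat t * c k \<in> hereditary_hull P (\<lambda>k. of_nat t * c k)" "c k \<in> hereditary_hull P c"
      using c mult unfolding hereditary_hull_def by blast+
    moreover have "of_nat t * c k + c k - z \<in> P" using z by (simp add: algebra_simps)
    ultimately show "z \<in> isum P (hereditary_hull P (\<lambda>k. of_nat t * c k)) (hereditary_hull P c)"
      using z unfolding isum_def pleq_def by blast
  qed
  finally show ?case .
qed

lemma (in finely_divisible) ex_simple_riesz_cone:
  "\<exists>P. po_group G P \<and> simple_group G P \<and> riesz_group G P \<and> rank_one G \<and>
     (\<forall>q\<ge>1. \<exists>D. interval P D \<and> countably_generated P D \<and>
        (\<forall>t. 1 \<le> t \<and> t < q \<longrightarrow> imult P t D \<noteq> P) \<and> imult P q D = P)"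
proof -
  obtain u M d where u: "u > 0" and st: "\<And>k. stage G u (M k) (d k)"
    and ext: "\<And>k. extends (M k) (d k) (M (Suc k)) (d (Suc k))"
    and handles: "\<And>w x y z q k0. \<exists>k\<ge>k0. handles w x y z q (M k) (M (Suc k)) (d (Suc k))"
    using ex_stage_chain by blast
  define P where "P = (\<Union>k. M k)"
  have dc: "discrete_cone G (M k)" for k using st unfolding stage_def by blast
  have mono: "M k \<subseteq> M l" if "k \<le> l" for k l
    using lift_Suc_mono_le[of M k l] ext that unfolding extends_def by blast
  have zero: "0 \<in> P" using dc[of 0] unfolding discrete_cone_def P_def by blast
  have add: "x + y \<in> P" if xy: "x \<in> P" "y \<in> P" for x y
  proof -
    obtain k l where "x \<in> M k" "y \<in> M l" using xy unfolding P_def by blast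
    then have "x \<in> M (max k l)" "y \<in> M (max k l)" 
      using mono[of k "max k l"] mono[of l "max k l"] by auto
    then have "x + y \<in> M (max k l)" using dc[of "max k l"] unfolding discrete_cone_def by blast
    then show ?thesis unfolding P_def by blast
  qed
  have nonneg: "x \<ge> 0" if "x \<in> P" for x
    using that discrete_cone_nonneg[OF dc] unfolding P_def by blast
  have PG: "P \<subseteq> G" using discrete_cone_subset[OF subgroup dc] unfolding P_def by blast
  have "u \<in> M 0" using st unfolding stage_def by blast
  then have uP: "u \<in> P" unfolding P_def by blast
  then have "G \<noteq> {0}" using PG u by auto
  have "po_group G P"
    unfolding po_group_def using subgroup PG zero add nonneg by (metis neg_0_le_iff_le order_antisym)
  moreover have "rank_one G" unfolding rank_one_def using subgroup \<open>G \<noteq> {0}\<close> by blast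
  moreover have "simple_group G P"
  proof -
    have "\<exists>n. of_nat n * w - x \<in> P" if w: "w \<in> P" "w \<noteq> 0" "x \<in> G" for w x
    proof -
      obtain k0 where k0: "w \<in> M k0" using w unfolding P_def by blast
      obtain k where k: "k \<ge> k0" "handles w x 0 0 0 (M k) (M (Suc k)) (d (Suc k))"
        using handles by blast
      then have "w \<in> M k" using mono k0 by blast
      then show ?thesis using k w unfolding handles_def P_def by blast
    qed
    then show ?thesis using \<open>G \<noteq> {0}\<close> unfolding simple_group_def order_unit_def pleq_def by blast
  qed
  moreover have "riesz_group G P"
    unfolding riesz_group_def pleq_def
  proof (intro ballI impI)
    fix x y1 y2 assume xy: "x \<in> P" "y1 \<in> P" "y2 \<in> P" "y1 + y2 - x \<in> P"
    then obtain k1 k2 k3 k4 where "x \<in> M k1" "y1 \<in> M k2" "y2 \<in> M k3" "y1 + y2 - x \<in> M k4"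
      unfolding P_def by blast
    moreover define k0 where "k0 = k1 + k2 + k3 + k4"
    ultimately have k0: "x \<in> M k0" "y1 \<in> M k0" "y2 \<in> M k0" "y1 + y2 - x \<in> M k0"
      using mono[of k1 k0] mono[of k2 k0] mono[of k3 k0] mono[of k4 k0] by auto
    obtain k where k: "k \<ge> k0" "handles x (y1 + y2 - x) y1 y2 0 (M k) (M (Suc k)) (d (Suc k))"
      using handles by blast
    have "M k0 \<subseteq> M k" using mono k by blast
    then have "x \<in> M k" "y1 \<in> M k" "y2 \<in> M k" "y1 + y2 - x \<in> M k" using k0 by blast+
    moreover have "x + (y1 + y2 - x) = y1 + y2" by simp
    ultimately have "\<exists>t\<in>M (Suc k). x - t \<in> M (Suc k) \<and> y1 - t \<in> M (Suc k) \<and>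
        (y1 + y2 - x) - y1 + t \<in> M (Suc k)"
      using k(2) unfolding handles_def by blast
    then obtain t where "t \<in> P" "x - t \<in> P" "y1 - t \<in> P" "(y1 + y2 - x) - y1 + t \<in> P"
      unfolding P_def by blast
    then have "x = t + (x - t)" "t \<in> P" "x - t \<in> P" "y1 - t \<in> P" "y2 - (x - t) \<in> P"
      by (simp_all add: algebra_simps)
    then show "\<exists>x1\<in>P. \<exists>x2\<in>P. x = x1 + x2 \<and> y1 - x1 \<in> P \<and> y2 - x2 \<in> P" by blast
  qed
  moreover have "\<exists>D. interval P D \<and> countably_generated P D \<and>
      (\<forall>t. 1 \<le> t \<and> t < q \<longrightarrow> imult P t D \<noteq> P) \<and> imult P q D = P" if q: "q \<ge> 1" for q
  proof -
    define c where "c = (\<lambda>k. d k q)"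
    have c: "c k \<in> P" "c (Suc k) - c k \<in> P" for k
      using st[of k] ext[of k] unfolding c_def P_def stage_def extends_def by blast+
    have cn: "of_nat n * c k \<in> P" for n k
      using zero add c by (induction n) (auto simp: distrib_right)
    have "imult P t (hereditary_hull P c) \<noteq> P" if t: "1 \<le> t" "t < q" for t
    proof
      assume "imult P t (hereditary_hull P c) = P"
      then have "u \<in> hereditary_hull P (\<lambda>k. of_nat t * c k)"
        using uP imult_hereditary_hull[of P c, OF zero add c t(1)] by simp
      then obtain k l where kl: "of_nat t * c k - u \<in> M l"
        unfolding hereditary_hull_def P_def by blast
      have "of_nat t * c m - u \<in> M (max l m)" if "k \<le> m" for m
        using that
      proof (induction rule: dec_induct)
        case base
        then show ?case using kl mono[of l "max l k"] by auto
      next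
        case (step m)
        have "c (Suc m) - c m \<in> M (Suc m)" using ext[of m] unfolding c_def extends_def by blast
        then have "of_nat t * (c (Suc m) - c m) \<in> M (max l (Suc m))"
          using mono[of "Suc m" "max l (Suc m)"] discrete_cone_mult_nat[OF dc] by auto
        moreover have "of_nat t * c m - u \<in> M (max l (Suc m))"
          using step.IH mono[OF max.mono[OF order_refl le_SucI[OF order_refl]]] by blast
        ultimately have "of_nat t * (c (Suc m) - c m) + (of_nat t * c m - u) \<in> M (max l (Suc m))"
          using dc[of "max l (Suc m)"] unfolding discrete_cone_def by blast
        then show ?case by (simp add: algebra_simps)
      qed
      from this[of "max k l"] have "of_nat t * d (max k l) q - u \<in> M (max k l)"
        by (simp add: c_def)
      then show False using st t unfolding stage_def by blast
    qed
    moreover have "imult P q (hereditary_hull P c) = P"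
    proof -
      have "z \<in> hereditary_hull P (\<lambda>k. of_nat q * c k)" if z: "z \<in> P" for z
      proof -
        obtain k0 where k0: "z \<in> M k0" using z unfolding P_def by blast
        obtain k where k: "k \<ge> k0" "handles z 0 0 0 q (M k) (M (Suc k)) (d (Suc k))"
          using handles by blast
        have "z \<in> M k" using mono k0 k by blast
        then have "of_nat q * c (Suc k) - z \<in> P"
          using k q unfolding handles_def P_def c_def by blast
        then show ?thesis using z unfolding hereditary_hull_def by blast
      qed
      then have "hereditary_hull P (\<lambda>k. of_nat q * c k) = P"
        unfolding hereditary_hull_def by blast
      then show ?thesis using imult_hereditary_hull[of P c, OF zero add c q] by simp
    qed
    ultimately show ?thesis
      using interval_hereditary_hull[of P c, OF zero add c] countably_generated_rat[OF zero] by blast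
  qed
  ultimately show ?thesis by blast
qed

lemma gi_dvd_lcm:
  assumes "gi_dvd b n" "gi_dvd c n"
  shows "gi_dvd (lcm b c) n"
proof -
  have "enat (multiplicity p (lcm b c)) \<le> n p" if "prime p" for p
    using assms that by (auto simp: gi_dvd_def multiplicity_lcm max_def)
  then show ?thesis using assms unfolding gi_dvd_def by (auto intro: lcm_pos_nat)
qed

lemma subgroup_Z_gi: "subgroup_rat (Z_gi n)"
proof -
  have "x + y \<in> Z_gi n" if xy: "x \<in> Z_gi n" "y \<in> Z_gi n" for x y
  proof -
    obtain a b c d where ab: "x = of_int a / of_nat b" "gi_dvd b n"
      and cd: "y = of_int c / of_nat d" "gi_dvd d n"
      using xy unfolding Z_gi_def by blast
    obtain i j where ij: "lcm b d = b * i" "lcm b d = d * j"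
      by (meson dvdE dvd_lcm1 dvd_lcm2)
    have pos: "b > 0" "d > 0" using ab cd unfolding gi_dvd_def by simp_all
    then have "lcm b d > 0" by (simp add: lcm_pos_nat)
    then have ij0: "i > 0" "j > 0" using ij by (metis gr0I mult_0_right less_irrefl)+
    have "x = of_int (a * int i) / of_nat (lcm b d)"
      using pos ij0 unfolding ij(1) ab(1) by simp
    moreover have "y = of_int (c * int j) / of_nat (lcm b d)"
      using pos ij0 unfolding ij(2) cd(1) by simp
    ultimately have "x + y = of_int (a * int i + c * int j) / of_nat (lcm b d)"
      by (simp add: add_divide_distrib)
    then show ?thesis using gi_dvd_lcm[OF ab(2) cd(2)] unfolding Z_gi_def by blast
  qed
  moreover have "- x \<in> Z_gi n" if x: "x \<in> Z_gi n" for x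
  proof -
    obtain a b where "x = of_int a / of_nat b" "gi_dvd b n" using x unfolding Z_gi_def by blast
    moreover from this have "- x = of_int (- a) / of_nat b" by simp
    ultimately show ?thesis unfolding Z_gi_def by blast
  qed
  moreover have "gi_dvd 1 n" by (simp add: gi_dvd_def zero_enat_def[symmetric])
  moreover have "(0 :: rat) = of_int 0 / of_nat 1" by simp
  then have "0 \<in> Z_gi n" using \<open>gi_dvd 1 n\<close> unfolding Z_gi_def by blast
  ultimately show ?thesis unfolding subgroup_rat_def by blast
qed

lemma gi_infinite_ex_large_dvd:
  assumes "gi_infinite n"
  shows "\<exists>b\<ge>N. gi_dvd b n"
proof (cases "\<exists>p. prime p \<and> n p = \<infinity>")
  case True
  then obtain p where p: "prime p" "n p = \<infinity>" by blast
  have "enat (multiplicity r (p ^ N)) \<le> n r" if "prime r" for r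
  proof (cases "r = p")
    case True
    then show ?thesis using p by simp
  next
    case False
    then have "multiplicity r (p ^ N) = 0"
      using p that by (intro not_dvd_imp_multiplicity_0) (metis prime_dvd_power primes_dvd_imp_eq)
    then show ?thesis by (simp add: zero_enat_def[symmetric])
  qed
  then have "gi_dvd (p ^ N) n" using p by (simp add: gi_dvd_def prime_gt_0_nat)
  moreover have "N \<le> p ^ N" using power_gt_expt[of p N] prime_gt_1_nat[OF p(1)] by simp
  ultimately show ?thesis by blast
next
  case False
  then have "infinite {p. prime p \<and> n p \<noteq> 0}"
    using assms unfolding gi_infinite_def gi_finite_def by auto
  then have "\<exists>p\<ge>N. p \<in> {p. prime p \<and> n p \<noteq> 0}"
    unfolding infinite_nat_iff_unbounded_le by (rule spec)
  then obtain p where p: "p \<ge> N" "prime p" "n p \<noteq> 0" by blast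
  have "enat (multiplicity r p) \<le> n r" if "prime r" for r
  proof (cases "r = p")
    case True
    moreover have "multiplicity p p = 1"
      using prime_gt_1_nat[OF p(2)] by (intro multiplicity_self) auto
    ultimately show ?thesis using p(3) by (cases "n p") (auto simp: zero_enat_def)
  next
    case False
    then have "multiplicity r p = 0"
      using p that by (intro not_dvd_imp_multiplicity_0) (metis primes_dvd_imp_eq)
    then show ?thesis by (simp add: zero_enat_def[symmetric])
  qed
  then have "gi_dvd p n" using p by (simp add: gi_dvd_def prime_gt_0_nat)
  then show ?thesis using p by blast
qed

lemma finely_divisible_Z_gi:
  assumes "gi_infinite n"
  shows "finely_divisible (Z_gi n)"
proof
  show "subgroup_rat (Z_gi n)" by (rule subgroup_Z_gi)
  have "gi_dvd 1 n" by (simp add: gi_dvd_def zero_enat_def[symmetric])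
  moreover have "(1 :: rat) = of_int 1 / of_nat 1" by simp
  ultimately have "1 \<in> Z_gi n" unfolding Z_gi_def by blast
  then show "\<exists>g\<in>Z_gi n. g > 0" by (intro bexI[of _ 1]) auto
  fix g N assume g: "g \<in> Z_gi n" "g > 0"
  then obtain a b where ab: "g = of_int a / of_nat b" "gi_dvd b n" unfolding Z_gi_def by blast
  have b: "b > 0" using ab unfolding gi_dvd_def by simp
  have a: "a > 0" using ab g b by (simp add: zero_less_divide_iff)
  obtain c where c: "c \<ge> N * b" "gi_dvd c n" using gi_infinite_ex_large_dvd[OF assms] by blast
  have c0: "c > 0" using c unfolding gi_dvd_def by simp
  define l where "l = lcm b c"
  obtain i where i: "l = b * i" unfolding l_def by (meson dvdE dvd_lcm1)
  have l0: "l > 0" using b c0 unfolding l_def by (simp add: lcm_pos_nat)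
  then have i0: "i > 0" using i by (metis gr0I mult_0_right less_irrefl)
  have "c \<le> l" using l0 unfolding l_def by (simp add: dvd_imp_le)
  then have "N * b \<le> i * b" using c(1) i by (metis le_trans mult.commute)
  then have "N \<le> i" using b by simp
  also have "i \<le> nat a * i" using a by (cases "nat a") auto
  finally have "N \<le> nat a * i" .
  moreover have "g = of_nat (nat a * i) * (of_int 1 / of_nat l)"
    using a b i0 unfolding ab(1) i by simp
  moreover have "of_int 1 / of_nat l \<in> Z_gi n"
    using gi_dvd_lcm[OF ab(2) c(2)] unfolding l_def Z_gi_def by blast
  ultimately show "\<exists>h\<in>Z_gi n. \<exists>K\<ge>N. g = of_nat K * h" by blast
qed

theorem theorem3p4:
  fixes q :: "nat \<Rightarrow> nat" and a :: "nat \<Rightarrow> nat"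
  assumes coprime_q: "\<forall>i\<ge>1. \<forall>j\<ge>1. i \<noteq> j \<longrightarrow> coprime (q i) (q j)"
    and a_in_J: "\<forall>j\<ge>1. \<exists>i\<ge>1. a j = q i"
    and a_inf: "\<forall>i\<ge>1. infinite {j. j \<ge> 1 \<and> a j = q i}"
  shows "\<forall>m. gi_infinite m \<and> gi_coprime m (gi_inf_prod q) \<longrightarrow>
    (\<exists>G P. po_group G P \<and> simple_group G P \<and> riesz_group G P \<and> rank_one G \<and>
       (\<forall>i\<ge>1. \<exists>D. interval P D \<and> countably_generated P D \<and>
            (\<forall>t::nat. 1 \<le> t \<and> int t \<le> int (q i) - 1 \<longrightarrow> imult P t D \<noteq> P) \<and>
            imult P (q i) D = P) \<and>
       group_iso_rat G (Z_gi (gi_mult (gi_inf_prod q) m)))"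
proof (intro allI impI)
  fix m assume m: "gi_infinite m \<and> gi_coprime m (gi_inf_prod q)"
  define n where "n = gi_mult (gi_inf_prod q) m"
  have le: "m p \<le> n p" for p by (simp add: n_def gi_mult_def)
  have "gi_infinite n"
    unfolding gi_infinite_def
  proof
    assume n: "gi_finite n"
    have "m p \<noteq> \<infinity>" if "prime p" for p
      using n le[of p] that unfolding gi_finite_def by (metis enat_ord_simps(5))
    moreover have "m p = 0" if "n p = 0" for p using le[of p] that by simp
    then have "{p. prime p \<and> m p \<noteq> 0} \<subseteq> {p. prime p \<and> n p \<noteq> 0}" by blast
    ultimately have "gi_finite m"
      using n finite_subset unfolding gi_finite_def by blast
    then show False using m unfolding gi_infinite_def by blast
  qed
  then interpret finely_divisible "Z_gi n" by (rule finely_divisible_Z_gi)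
  obtain P where P: "po_group (Z_gi n) P" "simple_group (Z_gi n) P" "riesz_group (Z_gi n) P"
    "rank_one (Z_gi n)"
    and D: "\<And>r. r \<ge> 1 \<Longrightarrow> \<exists>D. interval P D \<and> countably_generated P D \<and>
        (\<forall>t. 1 \<le> t \<and> t < r \<longrightarrow> imult P t D \<noteq> P) \<and> imult P r D = P"
    using ex_simple_riesz_cone by blast
  have "q i \<ge> 1" if "i \<ge> 1" for i
  proof (rule ccontr)
    assume "\<not> q i \<ge> 1"
    then have "q i = 0" by simp
    then have "gi_inf_prod q p \<noteq> 0" if "prime p" for p
      using \<open>i \<ge> 1\<close> that unfolding gi_inf_prod_def by (auto intro!: exI[of _ i])
    then have m0: "m p = 0" if "prime p" for p
      using m that unfolding gi_coprime_def by blast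
    then have none: "{p. prime p \<and> m p \<noteq> 0} = {}" by blast
    have "gi_finite m" unfolding gi_finite_def none using m0 by simp
    then show False using m unfolding gi_infinite_def by blast
  qed
  then have "\<exists>D. interval P D \<and> countably_generated P D \<and>
      (\<forall>t::nat. 1 \<le> t \<and> int t \<le> int (q i) - 1 \<longrightarrow> imult P t D \<noteq> P) \<and> imult P (q i) D = P"
    if "i \<ge> 1" for i
  proof -
    have "t < q i" if "int t \<le> int (q i) - 1" for t :: nat using that by linarith
    moreover have "q i \<ge> 1" using that \<open>\<And>i. i \<ge> 1 \<Longrightarrow> q i \<ge> 1\<close> by blast
    ultimately show ?thesis using D[of "q i"] by metis
  qed
  moreover have "group_iso_rat (Z_gi n) (Z_gi n)"
    unfolding group_iso_rat_def by (intro exI[of _ id]) auto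
  ultimately show "\<exists>G P. po_group G P \<and> simple_group G P \<and> riesz_group G P \<and> rank_one G \<and>
       (\<forall>i\<ge>1. \<exists>D. interval P D \<and> countably_generated P D \<and>
            (\<forall>t::nat. 1 \<le> t \<and> int t \<le> int (q i) - 1 \<longrightarrow> imult P t D \<noteq> P) \<and>
            imult P (q i) D = P) \<and>
       group_iso_rat G (Z_gi (gi_mult (gi_inf_prod q) m))"
    using P unfolding n_def by blast
qed

end
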